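(* Let $p$ be a prime, $r\le s$ positive integers and $k\geq0$ an integer. Then $\lambda(p^kr,p^ks,p)$ is the $p^k$-multiple of $\lambda(r,s,p)$: if $\lambda(r,s,p)=(\lambda_1,\dots,\lambda_r)$ then $\lambda(p^kr,p^ks,p)$ is the partition of length $p^kr$ in which each $p^k\lambda_i$ appears $p^k$ times for each $i$, i.e. $(p^k\lambda_1,\dots,p^k\lambda_1,\dots,p^k\lambda_r,\dots,p^k\lambda_r)$.
   Context: For a positive integer $n$, let $J_n$ denote the $n\times n$ matrix with $1$s in positions $(i,i)$ for $1\le i\le n$ and $(i,i+1)$ for $1\le i<n$, and $0$s elsewhere. For $1\le r\le s$ and a field $F$ of characteristic $p$, the Jordan canonical form of $J_r\otimes J_s$ over $F$ is $J_{\lambda_1}\oplus\cdots\oplus J_{\lambda_r}$ with $\lambda_1\ge\cdots\ge\lambda_r>0$; write $\lambda(r,s,p)=(\lambda_1,\dots,\lambda_r)$, a partition of $rs$ depending only on $r,s,p$. *)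

theory Defs
  imports "Jordan_Normal_Form.Jordan_Normal_Form" "HOL-Computational_Algebra.Primes"
begin

definition kron_mat :: "'a :: times mat \<Rightarrow> 'a mat \<Rightarrow> 'a mat" where
  "kron_mat A B = mat (dim_row A * dim_row B) (dim_col A * dim_col B)
     (\<lambda>(i,j). A $$ (i div dim_row B, j div dim_col B) * B $$ (i mod dim_row B, j mod dim_col B))"

abbreviation J :: "nat \<Rightarrow> 'a :: {zero,one} mat" where
  "J n \<equiv> jordan_block n 1"

definition unipotent_jcf :: "'a :: field mat \<Rightarrow> nat list \<Rightarrow> bool" where
  "unipotent_jcf A ls = jordan_nf A (map (\<lambda>l. (l, 1)) ls)"

end

theory Submission
  imports Defs
begin

text \<open>
  Identify row vectors of length \<open>r s\<close> with \<open>F[x, y] / (x\<^sup>r, y\<^sup>s)\<close>; then \<open>J\<^sub>r \<otimes> J\<^sub>s\<close> acts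
  from the right as multiplication by \<open>(1 + x) (1 + y) = 1 + z\<close>. For \<open>q = p\<^sup>k\<close>, the
  substitution \<open>\<phi>: x \<mapsto> x\<^sup>q, y \<mapsto> y\<^sup>q\<close> maps \<open>z\<close> to \<open>z\<^sup>q\<close>. Given generators \<open>v\<^sub>i\<close> of Jordan chains
  of lengths \<open>\<lambda>\<^sub>i\<close> modulo \<open>(x\<^sup>r, y\<^sup>s)\<close>, the \<open>x\<^sup>a \<phi>(v\<^sub>i)\<close> with \<open>a < q\<close> generate chains of lengths
  \<open>q \<lambda>\<^sub>i\<close> modulo the ideal generated by the \<open>qr\<close>-th power of \<open>x\<close> and the \<open>qs\<close>-th power of \<open>y\<close>.
  Their span contains every \<open>x\<^sup>a z\<^sup>c\<close>, and it is everything since \<open>y = (z - x) / (1 + x)\<close> where \<open>x\<close>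
  is nilpotent. Counting dimensions, the chains form a basis.
\<close>

section \<open>The ideal generated by \<open>x^r\<close> and \<open>y^s\<close>, and Jordan chains
  modulo it\<close>

text \<open>Elements of \<open>F[x, y]\<close> have type \<open>'a poly poly\<close>: \<open>x\<close> is the outer variable \<open>[:0, 1:]\<close>
  and \<open>y\<close> the inner one, \<open>[:[:0, 1:]:]\<close>.\<close>

definition trunc_ideal :: "nat \<Rightarrow> nat \<Rightarrow> 'a :: comm_ring_1 poly poly set" where
  "trunc_ideal r s = {f. \<forall>i<r. \<forall>j<s. coeff (coeff f i) j = 0}"

text \<open>\<open>(1 + x) (1 + y) - 1\<close>\<close>

definition zvar :: "'a :: comm_ring_1 poly poly" where
  "zvar = [:[:0, 1:], [:1, 1:]:]"

definition const_subspace :: "'a :: comm_ring_1 poly poly set \<Rightarrow> bool" where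
  "const_subspace S \<longleftrightarrow> 0 \<in> S \<and> (\<forall>f\<in>S. \<forall>g\<in>S. f + g \<in> S) \<and> (\<forall>c. \<forall>f\<in>S. [:[:c:]:] * f \<in> S)"

text \<open>Spanning modulo the ideal is stated by quantifying over subspaces, which makes the
  preimage of a subspace under multiplication and substitution directly usable.\<close>

definition jordan_chains :: "nat \<Rightarrow> nat \<Rightarrow> (nat \<times> 'a :: comm_ring_1 poly poly) list \<Rightarrow> bool" where
  "jordan_chains r s cs \<longleftrightarrow>
     (\<forall>(l, v) \<in> set cs. zvar ^ l * v \<in> trunc_ideal r s) \<and>
     (\<forall>S. const_subspace S \<longrightarrow> trunc_ideal r s \<subseteq> S \<longrightarrow>
        (\<forall>(l, v) \<in> set cs. \<forall>j<l. zvar ^ j * v \<in> S) \<longrightarrow> S = UNIV)"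

lemma trunc_ideal_0: "0 \<in> trunc_ideal r s"
  by (simp add: trunc_ideal_def)

lemma trunc_ideal_add: "f \<in> trunc_ideal r s \<Longrightarrow> g \<in> trunc_ideal r s \<Longrightarrow> f + g \<in> trunc_ideal r s"
  by (simp add: trunc_ideal_def)

lemma trunc_ideal_mult: "f \<in> trunc_ideal r s \<Longrightarrow> g * f \<in> trunc_ideal r s"
  by (auto simp: trunc_ideal_def coeff_mult coeff_sum intro!: sum.neutral)

lemma x_power_in_trunc_ideal: "([:0, 1:] :: 'a :: comm_ring_1 poly poly) ^ r \<in> trunc_ideal r s"
proof -
  have "[:0, 1:] ^ r = (monom 1 r :: 'a poly poly)"
    by (simp add: monom_altdef)
  thus ?thesis by (auto simp: trunc_ideal_def)
qed

lemma const_subspaceD: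
  assumes "const_subspace S"
  shows "0 \<in> S" "f \<in> S \<Longrightarrow> g \<in> S \<Longrightarrow> f + g \<in> S" "f \<in> S \<Longrightarrow> [:[:c:]:] * f \<in> S"
    "f \<in> S \<Longrightarrow> g \<in> S \<Longrightarrow> f - g \<in> S"
proof -
  show *: "0 \<in> S" "\<And>f g. f \<in> S \<Longrightarrow> g \<in> S \<Longrightarrow> f + g \<in> S" "\<And>c f. f \<in> S \<Longrightarrow> [:[:c:]:] * f \<in> S"
    using assms unfolding const_subspace_def by blast+
  have "[:[:-1:]:] * g = - g" by (rule poly_eqI) simp
  thus "f - g \<in> S" if "f \<in> S" "g \<in> S"
    using *(2)[OF that(1) *(3)[OF that(2), of "-1"]] by simp
qed

lemma const_subspace_sum:
  assumes "const_subspace S" and "\<And>i. i \<in> A \<Longrightarrow> f i \<in> S"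
  shows "(\<Sum>i\<in>A. f i) \<in> S"
  using assms(2) by (induction A rule: infinite_finite_induct) (auto intro: const_subspaceD[OF assms(1)])

section \<open>Substituting \<open>q\<close>-th powers for both variables\<close>

text \<open>The inner composition acts on coefficients and sends \<open>y\<close> to
  \<open>y^q\<close>; the outer one, with \<open>monom 1 q\<close> read one level up, sends
  \<open>x\<close> to \<open>x^q\<close>.\<close>

definition power_subst :: "nat \<Rightarrow> 'a :: comm_ring_1 poly poly \<Rightarrow> 'a poly poly" where
  "power_subst q f = map_poly (\<lambda>c. c \<circ>\<^sub>p monom 1 q) f \<circ>\<^sub>p monom 1 q"

lemma comm_ring_hom_power_subst: "comm_ring_hom (power_subst q :: 'a :: comm_ring_1 poly poly \<Rightarrow> _)"
proof -
  interpret c: comm_ring_hom "\<lambda>c :: 'a poly. c \<circ>\<^sub>p monom 1 q"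
    by unfold_locales (auto simp: pcompose_add pcompose_mult)
  interpret m: map_poly_comm_ring_hom "\<lambda>c :: 'a poly. c \<circ>\<^sub>p monom 1 q" ..
  show ?thesis
    by unfold_locales (auto simp: power_subst_def pcompose_add pcompose_mult hom_distribs)
qed

text \<open>Only exponents divisible by \<open>q\<close> survive, and there the coefficient at
  \<open>(i, j)\<close> is the old one at \<open>(i div q, j div q)\<close>. These quotients stay
  below \<open>r\<close> and \<open>s\<close> when \<open>i < q * r\<close> and
  \<open>j < q * s\<close>.\<close>

lemma power_subst_trunc_ideal:
  fixes f :: "'a :: comm_ring_1 poly poly"
  assumes "q > 0" and "f \<in> trunc_ideal r s"
  shows "power_subst q f \<in> trunc_ideal (q * r) (q * s)"
proof -
  have *: "coeff (g \<circ>\<^sub>p monom 1 q) i = (if q dvd i then coeff g (i div q) else 0)" 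
    for g :: "'b :: comm_ring_1 poly" and i
    using coeff_pcompose_monom[of "i mod q" q g "i div q"] \<open>q > 0\<close>
    by (simp add: dvd_eq_mod_eq_0)
  show ?thesis
    using assms by (auto simp: trunc_ideal_def power_subst_def * coeff_map_poly less_mult_imp_div_less mult.commute)
qed

lemma power_subst_x: "power_subst q [:0, 1:] = [:0, 1:] ^ q"
  by (simp add: power_subst_def pcompose_pCons map_poly_pCons monom_altdef)

lemma power_subst_const: "power_subst q [:[:c:]:] = [:[:c:]:]"
  by (cases "c = 0") (simp_all add: power_subst_def map_poly_pCons)

text \<open>The characteristic enters here: \<open>y + (x + x y)\<close> is sent to
  \<open>y^q + (x^q + x^q y^q)\<close>, which is \<open>z^q\<close> because raising to a power of
  the characteristic is additive.\<close>

lemma power_subst_zvar: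
  fixes q :: nat
  assumes "prime CHAR('a :: comm_ring_1)" and "q = CHAR('a) ^ k"
  shows "power_subst q (zvar :: 'a poly poly) = zvar ^ q"
proof -
  interpret comm_ring_hom "power_subst q :: 'a poly poly \<Rightarrow> _"
    by (rule comm_ring_hom_power_subst)
  let ?x = "[:0, 1:] :: 'a poly poly" and ?y = "[:[:0, 1:]:] :: 'a poly poly"
  have z: "zvar = ?y + (?x + ?x * ?y)"
    by (simp add: zvar_def one_pCons)
  have pc: "[:c:] ^ n = [:c ^ n:]" for c :: "'a poly" and n
    by (induction n) (auto simp: mult.commute one_pCons)
  have y: "power_subst q ?y = ?y ^ q"
    by (simp add: power_subst_def map_poly_pCons monom_altdef pcompose_pCons pc)
  have fd: "(f + g) ^ q = f ^ q + g ^ q" for f g :: "'a poly poly"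
    using assms by (intro freshmans_dream'[of q k f g]) simp_all
  show ?thesis
    unfolding z fd by (simp only: hom_add hom_mult y power_subst_x power_mult_distrib)
qed

section \<open>Lifting Jordan chains along the substitution\<close>

lemma jordan_chains_power_subst:
  fixes cs :: "(nat \<times> 'a :: comm_ring_1 poly poly) list"
  assumes prime: "prime CHAR('a)" and q: "q = CHAR('a) ^ k" and cs: "jordan_chains r s cs"
  shows "jordan_chains (q * r) (q * s)
    (concat (map (\<lambda>(l, v). map (\<lambda>a. (q * l, [:0, 1:] ^ a * power_subst q v)) [0..<q]) cs))"
    (is "jordan_chains _ _ ?cs")
proof -
  interpret hom: comm_ring_hom "power_subst q :: 'a poly poly \<Rightarrow> _"
    by (rule comm_ring_hom_power_subst)
  let ?x = "[:0, 1:] :: 'a poly poly" and ?y = "[:[:0, 1:]:] :: 'a poly poly" and ?z = "zvar :: 'a poly poly"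
  note subst_z = power_subst_zvar[OF prime q]
  have q0: "q > 0" using prime q by (simp add: prime_gt_0_nat)
  have mem: "(l', w) \<in> set ?cs \<longleftrightarrow>
      (\<exists>l v a. (l, v) \<in> set cs \<and> a < q \<and> l' = q * l \<and> w = ?x ^ a * power_subst q v)" for l' w
    by force
  have "?z ^ l' * w \<in> trunc_ideal (q * r) (q * s)" if in_cs: "(l', w) \<in> set ?cs" for l' w
  proof -
    obtain l v a where *: "(l, v) \<in> set cs" "l' = q * l" "w = ?x ^ a * power_subst q v"
      using in_cs unfolding mem by blast
    have "?z ^ l * v \<in> trunc_ideal r s"
      using cs *(1) unfolding jordan_chains_def by blast
    \<comment> \<open>The new chain ends in time since
      \<open>z^(q l) x^a \<phi>(v) = x^a \<phi>(z^l v)\<close>.\<close>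
    from trunc_ideal_mult[OF power_subst_trunc_ideal[OF q0 this], of "?x ^ a"]
    show ?thesis
      unfolding *(2,3) power_mult by (simp only: hom.hom_mult hom.hom_power subst_z mult_ac)
  qed
  moreover have "S = UNIV"
    if S: "const_subspace S" and I: "trunc_ideal (q * r) (q * s) \<subseteq> S"
      and gen: "\<forall>(l, w) \<in> set ?cs. \<forall>j<l. ?z ^ j * w \<in> S" for S
  proof -
    note SD = const_subspaceD[OF S]
    have small: "?x ^ a * ?z ^ c * power_subst q f \<in> S" if "a < q" "c < q" for a c f
    proof -
      \<comment> \<open>The spanning property of the old chains is applied to the preimage of
        \<open>S\<close> under \<open>f \<mapsto> x^a z^c \<phi>(f)\<close>, a linear map because
        \<open>\<phi>\<close> fixes constants.\<close>
      let ?T = "{f. ?x ^ a * ?z ^ c * power_subst q f \<in> S}"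
      have "const_subspace ?T"
        unfolding const_subspace_def
      proof (intro conjI ballI allI; unfold mem_Collect_eq)
        show "?x ^ a * ?z ^ c * power_subst q 0 \<in> S" using SD by simp
      next
        fix f g assume "?x ^ a * ?z ^ c * power_subst q f \<in> S" "?x ^ a * ?z ^ c * power_subst q g \<in> S"
        from SD(2)[OF this] show "?x ^ a * ?z ^ c * power_subst q (f + g) \<in> S"
          by (simp only: hom.hom_add distrib_left)
      next
        fix b f assume "?x ^ a * ?z ^ c * power_subst q f \<in> S"
        from SD(3)[OF this, of b] show "?x ^ a * ?z ^ c * power_subst q ([:[:b:]:] * f) \<in> S"
          by (simp only: hom.hom_mult power_subst_const mult_ac)
      qed
      moreover have "trunc_ideal r s \<subseteq> ?T"
        using I power_subst_trunc_ideal[OF q0] trunc_ideal_mult by blast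
      moreover have "\<forall>(l, v) \<in> set cs. \<forall>j<l. ?z ^ j * v \<in> ?T"
      proof safe
        fix l v j assume *: "(l, v) \<in> set cs" "j < l"
        have "(q * l, ?x ^ a * power_subst q v) \<in> set ?cs"
          using *(1) \<open>a < q\<close> unfolding mem by blast
        \<comment> \<open>\<open>x^a z^c \<phi>(z^j v)\<close> is the vector at position
          \<open>c + q * j\<close> of a new chain; \<open>c < q\<close> and \<open>j < l\<close>
          keep this position inside the chain.\<close>
        moreover have "c + q * j < q * l"
        proof -
          have "c + q * j < q * Suc j" using \<open>c < q\<close> by simp
          also have "\<dots> \<le> q * l" using *(2) by (intro mult_le_mono2) simp
          finally show ?thesis .
        qed
        ultimately have "?z ^ (c + q * j) * (?x ^ a * power_subst q v) \<in> S"
          using gen by blast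
        thus "?x ^ a * ?z ^ c * power_subst q (?z ^ j * v) \<in> S"
          unfolding power_add power_mult
          by (simp only: hom.hom_mult hom.hom_power subst_z mult_ac)
      qed
      ultimately have "?T = UNIV"
        using cs unfolding jordan_chains_def by blast
      thus ?thesis by blast
    qed
    have all: "?x ^ a * ?z ^ c \<in> S" for a c
    proof -
      \<comment> \<open>Division of the exponents by \<open>q\<close>: the full \<open>q\<close>-th
        powers of \<open>x\<close> and \<open>z\<close> are values of \<open>\<phi>\<close>, and the
        remainders are covered by \<open>small\<close>.\<close>
      have "?x ^ a * ?z ^ c = ?x ^ (a mod q) * ?z ^ (c mod q) * power_subst q (?x ^ (a div q) * ?z ^ (c div q))"
      proof -
        have "u ^ n = u ^ (n mod q) * (u ^ q) ^ (n div q)" for u :: "'a poly poly" and n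
          by (simp flip: power_mult power_add)
        from this[of ?x a] this[of ?z c] show ?thesis
          by (simp only: hom.hom_mult hom.hom_power subst_z power_subst_x mult_ac)
      qed
      thus ?thesis using small[of "a mod q" "c mod q"] q0 by simp
    qed
    \<comment> \<open>\<open>D\<close> is the largest subset of \<open>S\<close> stable under
      multiplication by \<open>x\<close> and \<open>z\<close>. It contains \<open>1\<close>, so
      stability under \<open>y\<close> makes it everything.\<close>
    define D where "D = {f. \<forall>a c. ?x ^ a * ?z ^ c * f \<in> S}"
    have D: "const_subspace D"
      unfolding const_subspace_def
    proof (intro conjI ballI allI; unfold D_def mem_Collect_eq; intro allI)
      fix a c show "?x ^ a * ?z ^ c * 0 \<in> S" using SD by simp
    next
      fix f g a c assume "\<forall>a c. ?x ^ a * ?z ^ c * f \<in> S" "\<forall>a c. ?x ^ a * ?z ^ c * g \<in> S"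
      thus "?x ^ a * ?z ^ c * (f + g) \<in> S"
        by (simp only: distrib_left SD(2))
    next
      fix b f a c assume "\<forall>a c. ?x ^ a * ?z ^ c * f \<in> S"
      from SD(3)[OF this[rule_format], of b a c] show "?x ^ a * ?z ^ c * ([:[:b:]:] * f) \<in> S"
        by (simp only: mult_ac)
    qed
    note DD = const_subspaceD[OF D]
    have D1: "1 \<in> D" using all by (simp add: D_def)
    have Dx: "?x * f \<in> D" if "f \<in> D" for f
      unfolding D_def
    proof (safe)
      fix a c have "?x ^ Suc a * ?z ^ c * f \<in> S" using that unfolding D_def by blast
      thus "?x ^ a * ?z ^ c * (?x * f) \<in> S" by (simp only: power_Suc mult_ac)
    qed
    have Dz: "?z * f \<in> D" if "f \<in> D" for f
      unfolding D_def
    proof (safe)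
      fix a c have "?x ^ a * ?z ^ Suc c * f \<in> S" using that unfolding D_def by blast
      thus "?x ^ a * ?z ^ c * (?z * f) \<in> S" by (simp only: power_Suc mult_ac)
    qed
    have Dxn: "(-?x) ^ n * f \<in> D" if "f \<in> D" for f n
    proof (induction n)
      case (Suc n)
      from DD(4)[OF DD(1) Dx[OF Suc]] show ?case by (simp add: mult_ac)
    qed (use that in simp)
    have DI: "f \<in> D" if "f \<in> trunc_ideal (q * r) (q * s)" for f
      using that trunc_ideal_mult I unfolding D_def by blast
    have Dy: "?y * f \<in> D" if f: "f \<in> D" for f
    proof -
      let ?n = "q * r"
      \<comment> \<open>In \<open>y = (z - x) / (1 + x)\<close> the inverse is replaced by a
        geometric sum of \<open>q * r\<close> terms. By \<open>solve\<close>, the error in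
        \<open>y f\<close> is \<open>(-x)^(q r) y f\<close>, which lies in the ideal.\<close>
      have geo: "(1 + ?x) * (\<Sum>i<n. (-?x) ^ i) = 1 - (-?x) ^ n" for n
        using one_diff_power_eq[of "-?x" n] by (simp only: diff_minus_eq_add)
      have solve: "b * f = d * f + u * b * f" if "(1 - u) * b = d" for b d u
        by (simp add: that [symmetric] algebra_simps)
      have "(1 + ?x) * ?y = ?z - ?x"
        by (simp add: zvar_def one_pCons)
      hence "(\<Sum>i<?n. (-?x) ^ i) * ((1 + ?x) * ?y) = (\<Sum>i<?n. (-?x) ^ i * (?z - ?x))"
        by (simp only: sum_distrib_right)
      hence "(1 - (-?x) ^ ?n) * ?y = (\<Sum>i<?n. (-?x) ^ i * (?z - ?x))"
        by (simp only: geo [symmetric] mult_ac)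
      hence "?y * f = (\<Sum>i<?n. (-?x) ^ i * (?z - ?x)) * f + (-?x) ^ ?n * ?y * f"
        by (rule solve)
      also have "\<dots> = (\<Sum>i<?n. (-?x) ^ i * (?z * f - ?x * f)) + (-?x) ^ ?n * ?y * f"
        by (simp only: sum_distrib_right left_diff_distrib mult.assoc)
      also have "\<dots> \<in> D"
      proof (intro DD(2) const_subspace_sum[OF D] Dxn DD(4) Dx Dz f DI)
        have "(-1) ^ ?n * ?y * f * ?x ^ ?n \<in> trunc_ideal ?n (q * s)"
          by (rule trunc_ideal_mult[OF x_power_in_trunc_ideal])
        thus "(-?x) ^ ?n * ?y * f \<in> trunc_ideal ?n (q * s)"
          by (subst power_minus) (simp only: mult_ac)
      qed
      finally show ?thesis .
    qed
    \<comment> \<open>Horner's scheme, first in \<open>y\<close> for the coefficients, then in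
      \<open>x\<close>.\<close>
    have Dc: "[:g:] \<in> D" for g
    proof (induction g)
      case 0 show ?case using DD(1) by simp
    next
      case (pCons a g)
      have "[:[:a:]:] * 1 + ?y * [:g:] \<in> D"
        by (intro DD(2,3) Dy D1 pCons)
      thus ?case by simp
    qed
    have "f \<in> D" for f
    proof (induction f)
      case 0 show ?case using DD(1) by simp
    next
      case (pCons g f)
      have "[:g:] + ?x * f \<in> D" by (intro DD(2) Dc Dx pCons)
      thus ?case by simp
    qed
    hence "?x ^ 0 * ?z ^ 0 * f \<in> S" for f unfolding D_def by blast
    thus ?thesis by auto
  qed
  ultimately show ?thesis
    unfolding jordan_chains_def by blast
qed

section \<open>Coordinates modulo the ideal and the action of the Kronecker product\<close>

text \<open>In the Kronecker ordering, position \<open>t\<close> belongs to the monomial with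
  exponents \<open>t div s\<close> of \<open>x\<close> and \<open>t mod s\<close> of
  \<open>y\<close>.\<close>

definition kcoeff :: "nat \<Rightarrow> 'a :: comm_ring_1 poly poly \<Rightarrow> nat \<Rightarrow> 'a" where
  "kcoeff s f t = coeff (coeff f (t div s)) (t mod s)"

lemma kcoeff_add: "kcoeff s (f + g) t = kcoeff s f t + kcoeff s g t"
  by (simp add: kcoeff_def)

lemma kcoeff_diff: "kcoeff s (f - g) t = kcoeff s f t - kcoeff s g t"
  by (simp add: kcoeff_def)

lemma kcoeff_const_mult: "kcoeff s ([:[:c:]:] * f) t = c * kcoeff s f t"
  by (simp add: kcoeff_def)

lemma kcoeff_sum: "kcoeff s (\<Sum>i\<in>A. f i) t = (\<Sum>i\<in>A. kcoeff s (f i) t)"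
  by (simp add: kcoeff_def coeff_sum)

text \<open>The ideal is the kernel of the coordinate map, so congruence of polynomials becomes
  equality of vectors of length \<open>r * s\<close>.\<close>

lemma trunc_ideal_iff_kcoeff:
  "f \<in> trunc_ideal r s \<longleftrightarrow> (\<forall>t < r * s. kcoeff s f t = 0)"
proof safe
  fix t assume "f \<in> trunc_ideal r s" "t < r * s"
  moreover from this(2) have "t div s < r" "t mod s < s"
    by (auto simp: less_mult_imp_div_less intro!: mod_less_divisor gr0I)
  ultimately show "kcoeff s f t = 0"
    by (simp add: trunc_ideal_def kcoeff_def)
next
  assume *: "\<forall>t < r * s. kcoeff s f t = 0"
  show "f \<in> trunc_ideal r s"
    unfolding trunc_ideal_def
  proof safe
    fix i j assume ij: "i < r" "j < s"
    have "i * s + j < Suc i * s" using ij by simp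
    also have "\<dots> \<le> r * s" using ij by (intro mult_le_mono1) simp
    finally have "kcoeff s f (i * s + j) = 0" using * by blast
    thus "coeff (coeff f i) j = 0" using ij by (simp add: kcoeff_def)
  qed
qed

text \<open>Surjectivity of the coordinate map; it turns rows of a matrix into polynomials.\<close>

lemma ex_kcoeff:
  fixes w :: "nat \<Rightarrow> 'a :: comm_ring_1"
  shows "\<exists>f. \<forall>t < r * s. kcoeff s f t = w t"
proof -
  let ?f = "Poly (map (\<lambda>i. Poly (map (\<lambda>j. w (i * s + j)) [0..<s])) [0..<r])"
  have "kcoeff s ?f t = w t" if "t < r * s" for t
  proof -
    have "t div s < r" "t mod s < s"
      using that by (auto simp: less_mult_imp_div_less intro!: mod_less_divisor gr0I)
    thus ?thesis by (simp add: kcoeff_def nth_default_nth)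
  qed
  thus ?thesis by blast
qed

text \<open>On row vectors, \<open>J n\<close> follows the coefficient rule for multiplication by
  \<open>1 + x\<close>; position \<open>0\<close> has no predecessor.\<close>

lemma sum_mult_jordan_block:
  fixes h :: "nat \<Rightarrow> 'a :: comm_ring_1"
  assumes "b < n"
  shows "(\<Sum>a<n. h a * J n $$ (a, b)) = h b + (if b = 0 then 0 else h (b - 1))"
proof -
  have "(\<Sum>a<n. h a * J n $$ (a, b)) = (\<Sum>a<n. (if a = b then h a else 0) + (if Suc a = b then h a else 0))"
    using assms by (intro sum.cong) auto
  also have "\<dots> = h b + (\<Sum>a<n. if Suc a = b then h a else 0)"
    using assms by (simp add: sum.distrib)
  also have "(\<Sum>a<n. if Suc a = b then h a else 0) = (if b = 0 then 0 else h (b - 1))"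
  proof (cases b)
    case (Suc c)
    hence "(\<Sum>a<n. if Suc a = b then h a else 0) = (\<Sum>a<n. if a = c then h a else 0)"
      by (intro sum.cong) auto
    thus ?thesis using Suc assms by simp
  qed simp
  finally show ?thesis .
qed

text \<open>Row \<open>a\<close> of \<open>J n\<close> adds to the member \<open>a\<close> of a
  chain its successor; the last member has none.\<close>

lemma jordan_block_mult_sum:
  fixes h :: "nat \<Rightarrow> 'a :: comm_ring_1"
  assumes "a < n"
  shows "(\<Sum>b<n. J n $$ (a, b) * h b) = h a + (if Suc a < n then h (Suc a) else 0)"
proof -
  have "(\<Sum>b<n. J n $$ (a, b) * h b) = (\<Sum>b<n. (if b = a then h b else 0) + (if b = Suc a then h b else 0))"
    using assms by (intro sum.cong) auto
  thus ?thesis using assms by (simp add: sum.distrib)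
qed

lemma kron_jordan_block_index:
  assumes "i < r * s" "j < r * s"
  shows "kron_mat (J r) (J s) $$ (i, j) = J r $$ (i div s, j div s) * J s $$ (i mod s, j mod s)"
  using assms by (simp add: kron_mat_def)

lemma kron_mat_jordan_blocks_carrier: "kron_mat (J r) (J s) \<in> carrier_mat (r * s) (r * s)"
  by (simp add: kron_mat_def)

text \<open>The two tensor factors act on the two exponents separately, as multiplication by
  \<open>1 + x\<close> and by \<open>1 + y\<close>, whose product is
  \<open>1 + zvar\<close>.\<close>

lemma sum_kcoeff_kron_mat:
  fixes f :: "'a :: comm_ring_1 poly poly"
  assumes "t < r * s"
  shows "(\<Sum>i < r * s. kcoeff s f i * kron_mat (J r) (J s) $$ (i, t)) = kcoeff s ((1 + zvar) * f) t"
proof -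
  have ts: "t div s < r" "t mod s < s" and s: "s > 0"
    using assms by (auto simp: less_mult_imp_div_less intro!: mod_less_divisor gr0I)
  let ?g = "\<lambda>a b. coeff (coeff f a) b"
  let ?h = "\<lambda>a. ?g a (t mod s) + (if t mod s = 0 then 0 else ?g a (t mod s - 1))"
  \<comment> \<open>Grouping the positions into \<open>r\<close> runs of length \<open>s\<close>
    separates the exponent of \<open>x\<close> from that of \<open>y\<close>.\<close>
  have "(\<Sum>i < r * s. kcoeff s f i * kron_mat (J r) (J s) $$ (i, t))
      = (\<Sum>a<r. \<Sum>i = a * s..<a * s + s. kcoeff s f i * kron_mat (J r) (J s) $$ (i, t))"
    by (rule sum.nat_group [symmetric])
  also have "\<dots> = (\<Sum>a<r. (\<Sum>b<s. ?g a b * J s $$ (b, t mod s)) * J r $$ (a, t div s))"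
  proof (rule sum.cong[OF refl])
    fix a assume "a \<in> {..<r}"
    hence "Suc a * s \<le> r * s" by (intro mult_le_mono1) simp
    hence as: "a * s + b < r * s" if "b < s" for b using that by simp
    have "(\<Sum>i = a * s..<a * s + s. kcoeff s f i * kron_mat (J r) (J s) $$ (i, t))
        = (\<Sum>b<s. kcoeff s f (a * s + b) * kron_mat (J r) (J s) $$ (a * s + b, t))"
      by (rule sum.reindex_bij_witness[of _ "\<lambda>b. a * s + b" "\<lambda>i. i - a * s"]) auto
    also have "\<dots> = (\<Sum>b<s. ?g a b * J s $$ (b, t mod s) * J r $$ (a, t div s))"
      using as assms s by (intro sum.cong) (simp_all add: kron_jordan_block_index kcoeff_def mult_ac)
    finally show "(\<Sum>i = a * s..<a * s + s. kcoeff s f i * kron_mat (J r) (J s) $$ (i, t))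
        = (\<Sum>b<s. ?g a b * J s $$ (b, t mod s)) * J r $$ (a, t div s)"
      by (simp add: sum_distrib_right)
  qed
  also have "\<dots> = ?h (t div s) + (if t div s = 0 then 0 else ?h (t div s - 1))"
    by (simp only: sum_mult_jordan_block[OF ts(1)] sum_mult_jordan_block[OF ts(2)])
  also have "\<dots> = kcoeff s ((1 + zvar) * f) t"
  proof -
    have "(1 + zvar) * f = [:1, 1:] * ([:[:1, 1:]:] * f)"
      by (simp add: zvar_def one_pCons smult_add_right)
    thus ?thesis
      by (auto simp: kcoeff_def coeff_pCons split: nat.splits)
  qed
  finally show ?thesis .
qed

section \<open>Rows of Jordan matrices and the vectors of chains\<close>

text \<open>Peels off the first diagonal block, which permits induction on the list of chains; the
  remaining rows and columns are shifted by \<open>l\<close>.\<close>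

lemma jordan_matrix_Cons_mult_sum:
  fixes h :: "nat \<Rightarrow> 'a :: comm_ring_1" and n_as :: "(nat \<times> 'a) list"
  defines "m \<equiv> sum_list (map fst n_as)"
  assumes "t < l + m"
  shows "(\<Sum>u < l + m. jordan_matrix ((l, 1) # n_as) $$ (t, u) * h u) =
    (if t < l then h t + (if Suc t < l then h (Suc t) else 0)
     else \<Sum>u<m. jordan_matrix n_as $$ (t - l, u) * h (l + u))"
proof -
  have blk: "jordan_matrix ((l, 1) # n_as) = four_block_mat (J l) (0\<^sub>m l m) (0\<^sub>m m l) (jordan_matrix n_as)"
    using jordan_matrix_dim[of n_as] by (simp add: jordan_matrix_def Let_def m_def)
  have dim: "dim_row (jordan_matrix n_as) = m" "dim_col (jordan_matrix n_as) = m"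
    by (simp_all add: m_def)
  have ind: "jordan_matrix ((l, 1) # n_as) $$ (t, u) =
      (if t < l then if u < l then J l $$ (t, u) else 0
       else if u < l then 0 else jordan_matrix n_as $$ (t - l, u - l))" if "u < l + m" for u
    using assms(2) that unfolding blk by (subst index_mat_four_block(1)) (auto simp: m_def)
  have "(\<Sum>u < l + m. jordan_matrix ((l, 1) # n_as) $$ (t, u) * h u)
      = (\<Sum>u<l. jordan_matrix ((l, 1) # n_as) $$ (t, u) * h u)
        + (\<Sum>u<m. jordan_matrix ((l, 1) # n_as) $$ (t, l + u) * h (l + u))"
    by (induction m) (simp_all add: add.assoc)
  also have "\<dots> = (if t < l then (\<Sum>u<l. J l $$ (t, u) * h u)
      else \<Sum>u<m. jordan_matrix n_as $$ (t - l, u) * h (l + u))"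
    by (simp add: ind cong: if_cong)
  finally show ?thesis
    by (simp only: jordan_block_mult_sum cong: if_cong)
qed

text \<open>The order is that of the rows of the Jordan matrix: the superdiagonal entry in the row
  of \<open>z^j v\<close> points to \<open>z^(j+1) v\<close>.\<close>

definition chain_basis :: "(nat \<times> 'a :: comm_ring_1 poly poly) list \<Rightarrow> 'a poly poly list" where
  "chain_basis cs = concat (map (\<lambda>(l, v). map (\<lambda>j. zvar ^ j * v) [0..<l]) cs)"

lemma length_chain_basis: "length (chain_basis cs) = sum_list (map fst cs)"
  by (induction cs) (auto simp: chain_basis_def)

lemma chain_basis_Cons: "chain_basis ((l, v) # cs) = map (\<lambda>j. zvar ^ j * v) [0..<l] @ chain_basis cs"
  by (simp add: chain_basis_def)

text \<open>Inside a chain, \<open>(1 + z) z^j v = z^j v + z^(j+1) v\<close>. At its end the second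
  summand vanishes modulo the ideal, matching the row without superdiagonal entry.\<close>

lemma kcoeff_chain_basis:
  fixes cs :: "(nat \<times> 'a :: comm_ring_1 poly poly) list"
  assumes "\<forall>(l, v) \<in> set cs. zvar ^ l * v \<in> trunc_ideal r s"
    and "t < sum_list (map fst cs)" and "c < r * s"
  shows "kcoeff s ((1 + zvar) * (chain_basis cs ! t)) c =
    (\<Sum>u < sum_list (map fst cs). jordan_matrix (map (\<lambda>l. (l, 1)) (map fst cs)) $$ (t, u) * kcoeff s (chain_basis cs ! u) c)"
  using assms(1,2)
proof (induction cs arbitrary: t)
  case (Cons lv cs)
  obtain l v where lv: "lv = (l, v)" by force
  let ?ls = "map (\<lambda>l. (l, 1 :: 'a)) (map fst cs)"
  let ?b = "chain_basis ((l, v) # cs)"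
  have m: "sum_list (map fst ?ls) = sum_list (map fst cs)" by (simp add: o_def)
  have b1: "?b ! u = zvar ^ u * v" if "u < l" for u
    using that by (simp add: chain_basis_Cons nth_append)
  have b2: "?b ! (l + u) = chain_basis cs ! u" for u
    by (simp add: chain_basis_Cons nth_append)
  have vl: "kcoeff s (zvar ^ l * v) c = 0"
    using Cons.prems(1) assms(3) unfolding lv trunc_ideal_iff_kcoeff by auto
  have t: "t < l + sum_list (map fst ?ls)" using Cons.prems lv m by simp
  have "(\<Sum>u < l + sum_list (map fst ?ls). jordan_matrix ((l, 1) # ?ls) $$ (t, u) * kcoeff s (?b ! u) c)
      = kcoeff s ((1 + zvar) * (?b ! t)) c"
  proof (cases "t < l")
    case True
    have "(if Suc t < l then kcoeff s (?b ! Suc t) c else 0) = kcoeff s (zvar * (zvar ^ t * v)) c"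
    proof (cases "Suc t < l")
      case False
      hence "l = Suc t" using True by simp
      thus ?thesis using vl by (simp add: mult.assoc)
    qed (simp add: b1 mult.assoc)
    thus ?thesis
      unfolding jordan_matrix_Cons_mult_sum[OF t]
      using True by (simp add: b1 kcoeff_add distrib_right)
  next
    case False
    then obtain t' where t': "t = l + t'" using le_Suc_ex not_less by blast
    have "t' < sum_list (map fst cs)" using t unfolding t' m by simp
    with Cons.prems(1) have "kcoeff s ((1 + zvar) * (chain_basis cs ! t')) c =
      (\<Sum>u < sum_list (map fst cs). jordan_matrix ?ls $$ (t', u) * kcoeff s (chain_basis cs ! u) c)"
      by (intro Cons.IH) auto
    thus ?thesis
      unfolding jordan_matrix_Cons_mult_sum[OF t] using False
      by (simp only: t' b2 m if_False diff_add_inverse)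
  qed
  thus ?case by (simp add: lv o_def)
qed simp

text \<open>The converse reading: within a block the relations force \<open>H (Suc t)\<close> to be
  congruent to \<open>z H t\<close>, so the first vector of the block generates it, and the last
  relation makes \<open>z^l\<close> annihilate that generator.\<close>

lemma ex_jordan_chains:
  fixes H :: "nat \<Rightarrow> 'a :: comm_ring_1 poly poly"
  assumes "\<And>t c. t < sum_list ls \<Longrightarrow> c < r * s \<Longrightarrow>
    kcoeff s ((1 + zvar) * H t) c = (\<Sum>u < sum_list ls. jordan_matrix (map (\<lambda>l. (l, 1)) ls) $$ (t, u) * kcoeff s (H u) c)"
  shows "\<exists>cs. map fst cs = ls \<and> (\<forall>(l, v) \<in> set cs. zvar ^ l * v \<in> trunc_ideal r s) \<and>
    (\<forall>t < sum_list ls. \<exists>(l, v) \<in> set cs. \<exists>j<l. H t - zvar ^ j * v \<in> trunc_ideal r s)"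
  using assms
proof (induction ls arbitrary: H)
  case (Cons l ls)
  let ?ls = "map (\<lambda>l. (l, 1 :: 'a)) ls"
  have m: "sum_list (map fst ?ls) = sum_list ls" by (simp add: o_def)
  have rel: "kcoeff s ((1 + zvar) * H t) c =
     (if t < l then kcoeff s (H t) c + (if Suc t < l then kcoeff s (H (Suc t)) c else 0)
     else \<Sum>u < sum_list ls. jordan_matrix ?ls $$ (t - l, u) * kcoeff s (H (l + u)) c)"
    if t: "t < l + sum_list ls" and c: "c < r * s" for t c
    using Cons.prems[of t c] t c jordan_matrix_Cons_mult_sum[of t l ?ls "\<lambda>u. kcoeff s (H u) c"]
    unfolding m by simp
  have "\<exists>cs. map fst cs = ls \<and> (\<forall>(l, v) \<in> set cs. zvar ^ l * v \<in> trunc_ideal r s) \<and>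
    (\<forall>t < sum_list ls. \<exists>(l', v) \<in> set cs. \<exists>j<l'. H (l + t) - zvar ^ j * v \<in> trunc_ideal r s)"
    by (rule Cons.IH) (simp add: rel)
  then obtain cs where cs: "map fst cs = ls"
      "\<forall>(l, v) \<in> set cs. zvar ^ l * v \<in> trunc_ideal r s"
      "\<forall>t < sum_list ls. \<exists>(l', v) \<in> set cs. \<exists>j<l'. H (l + t) - zvar ^ j * v \<in> trunc_ideal r s"
    by blast
  \<comment> \<open>An empty block owns no vector of \<open>H\<close>. Its generator is
    \<open>0\<close> because \<open>z^0 v\<close> itself has to lie in the ideal.\<close>
  define v where "v = (if l = 0 then 0 else H 0)"
  have step: "zvar * H t - (if Suc t < l then H (Suc t) else 0) \<in> trunc_ideal r s" if "t < l" for t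
    unfolding trunc_ideal_iff_kcoeff
    using rel[of t] that by (auto simp: kcoeff_diff kcoeff_add distrib_right kcoeff_def[of s 0])
  have chain: "H t - zvar ^ t * v \<in> trunc_ideal r s" if "t < l" for t
    using that
  proof (induction t)
    case 0 thus ?case by (simp add: v_def trunc_ideal_0)
  next
    case (Suc t)
    have "(-1) * (zvar * H t - H (Suc t)) + zvar * (H t - zvar ^ t * v) \<in> trunc_ideal r s"
      using Suc step[of t] by (intro trunc_ideal_add trunc_ideal_mult) simp_all
    thus ?case by (simp add: algebra_simps)
  qed
  have last: "zvar ^ l * v \<in> trunc_ideal r s"
  proof (cases l)
    case 0 thus ?thesis by (simp add: v_def trunc_ideal_0)
  next
    case (Suc k)
    have "zvar * H k + (- zvar) * (H k - zvar ^ k * v) \<in> trunc_ideal r s"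
      using chain[of k] step[of k] Suc by (intro trunc_ideal_add trunc_ideal_mult[of _ r s "- zvar"]) simp_all
    thus ?thesis using Suc by (simp add: algebra_simps)
  qed
  have "\<exists>(l', w) \<in> set ((l, v) # cs). \<exists>j<l'. H t - zvar ^ j * w \<in> trunc_ideal r s"
    if "t < sum_list (l # ls)" for t
  proof (cases "t < l")
    case True thus ?thesis using chain by auto
  next
    case False
    then obtain t' where "t = l + t'" using le_Suc_ex not_less by blast
    thus ?thesis using cs(3) that by auto
  qed
  thus ?case using cs(1,2) last by (intro exI[of _ "(l, v) # cs"]) simp
qed simp

section \<open>Passing between Jordan forms and Jordan chains\<close>

lemma index_mult_mat_sum:
  assumes "A \<in> carrier_mat m n" "B \<in> carrier_mat n l" "i < m" "j < l"
  shows "(A * B) $$ (i, j) = (\<Sum>u<n. A $$ (i, u) * B $$ (u, j))"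
  using assms by (auto simp: scalar_prod_def atLeast0LessThan intro!: sum.cong)

text \<open>If \<open>K = P J Q\<close>, then \<open>Q K = J Q\<close> says that the rows of
  \<open>Q\<close>, read as polynomials, are multiplied by \<open>1 + z\<close> as the Jordan matrix
  prescribes. Invertibility of \<open>Q\<close> makes them span.\<close>

lemma unipotent_jcf_kron_imp_jordan_chains:
  fixes ls :: "nat list"
  assumes "unipotent_jcf (kron_mat (J r) (J s) :: 'a :: field mat) ls"
  shows "\<exists>cs :: (nat \<times> 'a poly poly) list. map fst cs = ls \<and> sum_list ls = r * s \<and> jordan_chains r s cs"
proof -
  let ?K = "kron_mat (J r) (J s) :: 'a mat" and ?n = "r * s"
  let ?J = "jordan_matrix (map (\<lambda>l. (l, 1)) ls) :: 'a mat"
  obtain P Q where wit: "similar_mat_wit ?K ?J P Q"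
    using assms unfolding unipotent_jcf_def jordan_nf_def similar_mat_def by blast
  note W = similar_mat_witD2[OF kron_mat_jordan_blocks_carrier wit]
  have n: "sum_list ls = ?n"
    using carrier_matD(1)[OF W(5)] by (simp add: o_def)
  have QK: "Q * ?K = ?J * Q"
  proof -
    have "Q * ?K = Q * (P * (?J * Q))"
      unfolding W(3) using assoc_mult_mat[OF W(6,5,7)] by simp
    also have "\<dots> = (Q * P) * (?J * Q)"
      by (rule assoc_mult_mat[OF W(7,6) mult_carrier_mat[OF W(5,7)], symmetric])
    finally show ?thesis
      unfolding W(2) left_mult_one_mat[OF mult_carrier_mat[OF W(5,7)]] .
  qed
  have "\<exists>H. \<forall>t. \<forall>c < ?n. kcoeff s (H t) c = Q $$ (t, c)"
    by (intro choice allI ex_kcoeff)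
  then obtain H where H: "\<And>t c. c < ?n \<Longrightarrow> kcoeff s (H t) c = Q $$ (t, c)" by blast
  have "kcoeff s ((1 + zvar) * H t) c = (\<Sum>u < sum_list ls. ?J $$ (t, u) * kcoeff s (H u) c)"
    if "t < sum_list ls" "c < ?n" for t c
  proof -
    have "kcoeff s ((1 + zvar) * H t) c = (Q * ?K) $$ (t, c)"
      using that n
      by (simp add: index_mult_mat_sum[OF W(7,4)] H sum_kcoeff_kron_mat [symmetric] del: index_mult_mat)
    also have "\<dots> = (\<Sum>u < sum_list ls. ?J $$ (t, u) * kcoeff s (H u) c)"
      unfolding QK using that n by (simp add: index_mult_mat_sum[OF W(5,7)] H del: index_mult_mat)
    finally show ?thesis .
  qed
  from ex_jordan_chains[OF this] obtain cs where cs: "map fst cs = ls"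
      "\<forall>(l, v) \<in> set cs. zvar ^ l * v \<in> trunc_ideal r s"
      "\<forall>t < sum_list ls. \<exists>(l, v) \<in> set cs. \<exists>j<l. H t - zvar ^ j * v \<in> trunc_ideal r s"
    by blast
  have "f \<in> S" if S: "const_subspace S" and I: "trunc_ideal r s \<subseteq> S"
    and gen: "\<forall>(l, v) \<in> set cs. \<forall>j<l. zvar ^ j * v \<in> S" for S and f :: "'a poly poly"
  proof -
    note SD = const_subspaceD[OF S]
    have HS: "H t \<in> S" if "t < ?n" for t
    proof -
      obtain l v j where "(l, v) \<in> set cs" "j < l" "H t - zvar ^ j * v \<in> trunc_ideal r s"
        using cs(3) \<open>t < ?n\<close> n by auto
      with gen I have "(H t - zvar ^ j * v) + zvar ^ j * v \<in> S"
        by (intro SD(2)) auto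
      thus ?thesis by simp
    qed
    \<comment> \<open>With \<open>f\<close> as a row vector, \<open>f = (f P) Q\<close>, so
      \<open>f P\<close> holds its coefficients with respect to the rows of
      \<open>Q\<close>.\<close>
    define a where "a t = (\<Sum>i < ?n. kcoeff s f i * P $$ (i, t))" for t
    let ?g = "\<Sum>t < ?n. [:[:a t:]:] * H t"
    have "kcoeff s f c = kcoeff s ?g c" if c: "c < ?n" for c
    proof -
      have "kcoeff s ?g c = (\<Sum>t < ?n. \<Sum>i < ?n. kcoeff s f i * (P $$ (i, t) * Q $$ (t, c)))"
        using c by (simp add: kcoeff_sum kcoeff_const_mult H a_def sum_distrib_right mult.assoc del: mult_pCons_left)
      also have "\<dots> = (\<Sum>i < ?n. kcoeff s f i * (\<Sum>t < ?n. P $$ (i, t) * Q $$ (t, c)))"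
        by (subst sum.swap) (simp add: sum_distrib_left)
      also have "\<dots> = (\<Sum>i < ?n. kcoeff s f i * (P * Q) $$ (i, c))"
        using c by (intro sum.cong) (simp_all add: index_mult_mat_sum[OF W(6,7)] del: index_mult_mat)
      also have "\<dots> = (\<Sum>i < ?n. if i = c then kcoeff s f i else 0)"
        unfolding W(1) using c by (intro sum.cong) auto
      finally show ?thesis using c by simp
    qed
    hence "f - ?g \<in> trunc_ideal r s"
      by (simp add: trunc_ideal_iff_kcoeff kcoeff_diff)
    moreover have "?g \<in> S"
      by (intro const_subspace_sum[OF S] SD(3) HS) simp
    ultimately have "(f - ?g) + ?g \<in> S" using I by (intro SD(2)) auto
    thus ?thesis by simp
  qed
  hence "jordan_chains r s cs"
    using cs(2) unfolding jordan_chains_def by blast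
  thus ?thesis using cs(1) n by blast
qed

text \<open>The chain vectors are the rows of \<open>Q\<close>. Spanning yields \<open>P\<close>
  with \<open>P Q = 1\<close>; as there are exactly \<open>r * s\<close> vectors, \<open>Q\<close>
  is square and hence invertible.\<close>

lemma jordan_chains_imp_unipotent_jcf_kron:
  fixes cs :: "(nat \<times> 'a :: field poly poly) list"
  assumes cs: "jordan_chains r s cs" and n: "sum_list (map fst cs) = r * s" and pos: "0 \<notin> fst ` set cs"
  shows "unipotent_jcf (kron_mat (J r) (J s) :: 'a mat) (map fst cs)"
proof -
  let ?K = "kron_mat (J r) (J s) :: 'a mat" and ?n = "r * s" and ?b = "chain_basis cs"
  let ?J = "jordan_matrix (map (\<lambda>l. (l, 1)) (map fst cs)) :: 'a mat"
  have K: "?K \<in> carrier_mat ?n ?n" by (rule kron_mat_jordan_blocks_carrier)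
  have "sum_list (map fst (map (\<lambda>l. (l, 1 :: 'a)) (map fst cs))) = ?n"
    using n by (simp add: o_def)
  hence J: "?J \<in> carrier_mat ?n ?n" by (metis jordan_matrix_carrier)
  define Q where "Q = mat ?n ?n (\<lambda>(t, c). kcoeff s (?b ! t) c)"
  have Q: "Q \<in> carrier_mat ?n ?n" by (simp add: Q_def)
  have QK: "Q * ?K = ?J * Q"
  proof (rule eq_matI)
    fix t c assume "t < dim_row (?J * Q)" "c < dim_col (?J * Q)"
    hence tc: "t < ?n" "c < ?n" using J Q by auto
    have "(Q * ?K) $$ (t, c) = kcoeff s ((1 + zvar) * (?b ! t)) c"
      using tc by (simp add: index_mult_mat_sum[OF Q K] sum_kcoeff_kron_mat [symmetric] del: index_mult_mat) (simp add: Q_def)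
    also have "\<dots> = (?J * Q) $$ (t, c)"
      unfolding index_mult_mat_sum[OF J Q tc]
      using kcoeff_chain_basis[of cs r s t c] cs tc n by (simp add: jordan_chains_def Q_def)
    finally show "(Q * ?K) $$ (t, c) = (?J * Q) $$ (t, c)" .
  qed (use Q K J in auto)
  \<comment> \<open>The polynomials whose coordinate vectors lie in the row space of
    \<open>Q\<close>.\<close>
  let ?S = "{f :: 'a poly poly. \<exists>a. \<forall>c < ?n. kcoeff s f c = (\<Sum>t < ?n. a t * kcoeff s (?b ! t) c)}"
  have "const_subspace ?S"
    unfolding const_subspace_def
  proof (intro conjI ballI allI)
    show "0 \<in> ?S" by (auto simp: kcoeff_def intro!: exI[of _ "\<lambda>_. 0"])
  next
    fix f g assume "f \<in> ?S" "g \<in> ?S"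
    then obtain a a' where "\<forall>c < ?n. kcoeff s f c = (\<Sum>t < ?n. a t * kcoeff s (?b ! t) c)"
      "\<forall>c < ?n. kcoeff s g c = (\<Sum>t < ?n. a' t * kcoeff s (?b ! t) c)" by blast
    thus "f + g \<in> ?S"
      by (auto simp: kcoeff_add distrib_right sum.distrib intro!: exI[of _ "\<lambda>t. a t + a' t"])
  next
    fix d f assume "f \<in> ?S"
    then obtain a where "\<forall>c < ?n. kcoeff s f c = (\<Sum>t < ?n. a t * kcoeff s (?b ! t) c)" by blast
    thus "[:[:d:]:] * f \<in> ?S"
      by (auto simp: kcoeff_const_mult sum_distrib_left mult.assoc simp del: mult_pCons_left
          intro!: exI[of _ "\<lambda>t. d * a t"])
  qed
  moreover have "trunc_ideal r s \<subseteq> ?S"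
    by (auto simp: trunc_ideal_iff_kcoeff intro!: exI[of _ "\<lambda>_. 0"])
  moreover have "zvar ^ j * v \<in> ?S" if "(l, v) \<in> set cs" "j < l" for l v j
  proof -
    have "zvar ^ j * v \<in> set ?b"
      using that by (force simp: chain_basis_def)
    then obtain t where t: "t < ?n" "?b ! t = zvar ^ j * v"
      unfolding in_set_conv_nth length_chain_basis n by blast
    have "(\<Sum>u < ?n. (if u = t then 1 else 0) * kcoeff s (?b ! u) c) = kcoeff s (?b ! t) c" for c
      using t(1) by (simp add: if_distrib[of "\<lambda>x. x * _"] cong: if_cong)
    thus ?thesis using t(2) by (auto intro!: exI[of _ "\<lambda>u. if u = t then 1 else 0"])
  qed
  ultimately have span: "?S = UNIV"
    using cs unfolding jordan_chains_def by blast
  \<comment> \<open>Each unit vector is a combination of the rows of \<open>Q\<close>; the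
    coefficients form a row of \<open>P\<close>.\<close>
  have "\<exists>a. \<forall>c < ?n. (if c = i then 1 else 0) = (\<Sum>t < ?n. a t * kcoeff s (?b ! t) c)" for i
  proof -
    obtain f :: "'a poly poly" where "\<forall>c < ?n. kcoeff s f c = (if c = i then 1 else 0)"
      using ex_kcoeff[of r s "\<lambda>c. if c = i then 1 else 0"] by blast
    moreover have "f \<in> ?S" using span by blast
    ultimately show ?thesis by auto
  qed
  then obtain a where a: "\<And>i c. c < ?n \<Longrightarrow> (\<Sum>t < ?n. a i t * kcoeff s (?b ! t) c) = (if c = i then 1 else 0)"
    by metis
  define P where "P = mat ?n ?n (\<lambda>(i, t). a i t)"
  have P: "P \<in> carrier_mat ?n ?n" by (simp add: P_def)
  have PQ: "P * Q = 1\<^sub>m ?n"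
  proof (rule eq_matI)
    fix i c assume "i < dim_row (1\<^sub>m ?n :: 'a mat)" "c < dim_col (1\<^sub>m ?n :: 'a mat)"
    thus "(P * Q) $$ (i, c) = 1\<^sub>m ?n $$ (i, c)"
      by (simp add: index_mult_mat_sum[OF P Q] del: index_mult_mat) (simp add: P_def Q_def a)
  qed (use P Q in auto)
  have QP: "Q * P = 1\<^sub>m ?n"
    by (rule mat_mult_left_right_inverse[OF P Q PQ])
  have "?K = P * Q * ?K" using PQ K by simp
  also have "\<dots> = P * ?J * Q"
    using assoc_mult_mat[OF P Q K] assoc_mult_mat[OF P J Q] QK by simp
  finally have "similar_mat_wit ?K ?J P Q"
    by (intro similar_mat_witI[OF PQ QP] K J P Q)
  thus ?thesis
    using pos unfolding unipotent_jcf_def jordan_nf_def similar_mat_def by (auto simp: image_image)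
qed

section \<open>Counting block sizes and conclusion\<close>

theorem theorem5:
  fixes p r s k :: nat and lam :: "nat list"
  assumes "prime p" and "0 < r" and "r \<le> s"
    and "CHAR('a :: field) = p"
    and "sorted_wrt (\<ge>) lam" and "0 \<notin> set lam"
    and "unipotent_jcf (kron_mat (J r) (J s) :: 'a mat) lam"
  shows "unipotent_jcf (kron_mat (J (p^k * r)) (J (p^k * s)) :: 'a mat)
           (concat (map (\<lambda>l. replicate (p^k) (p^k * l)) lam))"
proof -
  obtain cs :: "(nat \<times> 'a poly poly) list" where cs: "map fst cs = lam"
      "sum_list lam = r * s" "jordan_chains r s cs"
    using unipotent_jcf_kron_imp_jordan_chains[OF assms(7)] by blast
  define q where "q = p ^ k"
  define cs' where "cs' =
    concat (map (\<lambda>(l, v). map (\<lambda>a. (q * l, [:0, 1:] ^ a * power_subst q v)) [0..<q]) cs)"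
  have fst_cs': "map fst cs' = concat (map (\<lambda>l. replicate q (q * l)) lam)"
    unfolding cs'_def cs(1) [symmetric]
    by (induction cs) (auto simp: o_def map_replicate_const)
  \<comment> \<open>A block of size \<open>l\<close> becomes \<open>q\<close> blocks of size
    \<open>q * l\<close>, so the total grows by the factor \<open>q * q\<close>, exactly as the
    dimension does.\<close>
  have "sum_list (concat (map (\<lambda>l. replicate q (q * l)) lam)) = q * q * sum_list lam"
    by (induction lam) (auto simp: sum_list_replicate algebra_simps)
  hence sum: "sum_list (map fst cs') = (q * r) * (q * s)"
    unfolding fst_cs' cs(2) by simp
  have "q > 0" using assms(1) by (simp add: q_def prime_gt_0_nat)
  hence "0 \<notin> set (map fst cs')"
    unfolding fst_cs' using assms(6) by auto
  hence "unipotent_jcf (kron_mat (J (q * r)) (J (q * s)) :: 'a mat) (map fst cs')"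
    using jordan_chains_power_subst[OF _ _ cs(3), of q k] assms(1,4) sum
    unfolding cs'_def[symmetric]
    by (intro jordan_chains_imp_unipotent_jcf_kron) (auto simp: q_def)
  thus ?thesis unfolding fst_cs' q_def .
qed

end
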